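(* Let $u^\dagger$ be an $\Omega$-minimizing solution which satisfies, with some exponent $0<\kappa<p$, an approximate variational inequality (with element $\xi\in\partial\Omega(u^\dagger)$, constants $\varrho,\bar\alpha,\beta_1,\beta_2,\gamma$ and distance function $d$), and suppose $d(r)>0$ for all $r\ge0$. For $r>0$ define $$\Psi(r)=d(r)^{\frac{p-\kappa}{\kappa}}\,r^{-\frac{\gamma p}{\kappa}},\qquad \Phi(r)=d(r)^{\frac1\kappa}\,r^{-\frac{\gamma}{\kappa}}.$$ Let $\delta\mapsto\alpha(\delta)\in(0,\infty)$ be a parameter choice with $\delta^p=\alpha(\delta)\,d\bigl(\Psi^{-1}(\alpha(\delta))\bigr)$ for all sufficiently small $\delta>0$, and for each $\delta>0$ let $u_{\alpha(\delta)}^\delta$ be a minimizer of $\mathcal{T}_{\alpha(\delta)}^\delta$ over $D$. Then $$\mathcal{B}_\xi(u_{\alpha(\delta)}^\delta,u^\dagger)=O\bigl(d(\Phi^{-1}(\delta))\bigr)\quad\text{as }\delta\to0.$$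
   Context: Setting. $U$ is a real Hausdorff topological vector space with topology $\tau_U$, $V$ is a Hausdorff topological space with topology $\tau_V$; convergence of sequences in $\tau_U$ or $\tau_V$ is written $\rightharpoonup$. $U^*$ is the set of all $\tau_U$-continuous linear functionals on $U$. $F:D(F)\subseteq U\to V$ is a (possibly nonlinear) operator, $v^0\in V$ is the exact data, $\mathcal{S}:V\times V\to[0,\infty]$ is a similarity functional, $\Omega:U\to[0,\infty]$ is a stabilizing functional, $p\in(0,\infty)$ is a fixed exponent. For each noise level $\delta>0$, $v^\delta\in V$ is noisy data with $\mathcal{S}(v^\delta,v^0)\le\delta$ and $\mathcal{S}(v^0,v^\delta)\le\delta$. Put $D(\Omega)=\{u\in U:\Omega(u)<\infty\}$, $D=D(F)\cap D(\Omega)$, and for $\alpha>0$ $$\mathcal{T}_\alpha^\delta(u)=\mathcal{S}(F(u),v^\delta)^p+\alpha\Omega(u),\quad \mathcal{T}_\alpha^0(u)=\mathcal{S}(F(u),v^0)^p+\alpha\Omega(u),\quad M_\alpha(c)=\{u\in D:\mathcal{T}_\alpha^0(u)\le c\}.$$ Standing assumptions. (i) $F$ is sequentially continuous: $u_k\rightharpoonup u$ with $u,u_k\in D(F)$ implies $F(u_k)\rightharpoonup F(u)$. (ii) $D(F)$ is sequentially closed with respect to $\tau_U$. (iii) There is $u\in D$ with $F(u)=v^0$. (iv) (a) $\mathcal{S}(v,\tilde v)=0$ iff $v=\tilde v$; (b) there is $s\ge1$ with $\mathcal{S}(v_1,v_2)\le s\,\mathcal{S}(v_1,v_3)+s\,\mathcal{S}(v_3,v_2)$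 for all $v_1,v_2,v_3\in V$; (c) $v_k\rightharpoonup v$, $\tilde v_k\rightharpoonup\tilde v$ implies $\mathcal{S}(v,\tilde v)\le\liminf_k\mathcal{S}(v_k,\tilde v_k)$; (d) $\mathcal{S}(v_k,v)\to0$ implies $v_k\rightharpoonup v$; (e) if $\mathcal{S}(v_k,v)\to0$, $\mathcal{S}(v,v_k)\to0$ and $\mathcal{S}(\tilde v,v)<\infty$, then $\mathcal{S}(\tilde v,v_k)\to\mathcal{S}(\tilde v,v)$. (v) $\Omega$ is convex. (vi) $u_k\rightharpoonup u$ implies $\Omega(u)\le\liminf_k\Omega(u_k)$. (vii) For all $\alpha>0$, $c>0$, every sequence in $M_\alpha(c)$ has a $\tau_U$-convergent subsequence. The constant $s$ is the one in (iv)(b), and $c_p=1$ if $0<p<1$, $c_p=2^{p-1}$ if $p\ge1$. An $\Omega$-minimizing solution is an element $u^\dagger\in D$ with $F(u^\dagger)=v^0$ and $\Omega(u^\dagger)=\inf\{\Omega(u):u\in D,\ F(u)=v^0\}$. The subdifferential is $\partial\Omega(\tilde u)=\{\xi\in U^*:\Omega(u)\ge\Omega(\tilde u)+\xi(u-\tilde u)\ \forall u\in U\}$ for $\tilde u\in D(\Omega)$, and for $\xi\in\partial\Omega(\tilde u)$ the Bregman distance is $\mathcal{B}_\xi(u,\tilde u)=\Omega(u)-\Omega(\tilde u)-\xi(u-\tilde u)$. Approximate variational inequality. $u^\dagger$ satisfies an approximate variational inequality with exponent $\kappa>0$ if there are $\xi\in\partial\Omega(u^\dagger)$ and constants $\varrho>c_ps^p\Omega(u^\dagger)$,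 $\bar\alpha>0$, $\beta_1\in[0,1)$, $\beta_2\ge0$, $\gamma\ge0$ such that the distance function $d:[0,\infty)\to\mathbb{R}$, $$d(r)=-\min_{u\in M_{\bar\alpha}(\varrho\bar\alpha)}\bigl(\xi(u-u^\dagger)+\beta_1\mathcal{B}_\xi(u,u^\dagger)+\beta_2r^\gamma\mathcal{S}(F(u),F(u^\dagger))^\kappa\bigr),$$ satisfies $d(r)\to0$ as $r\to\infty$ (the minimum exists under the standing assumptions). When $d(r)>0$ for all $r\ge 0$, the functions $\Psi$ and $\Phi$ are strictly decreasing; $\Psi^{-1}$ and $\Phi^{-1}$ denote their inverse functions. *)

theory Defs
  imports "HOL-Analysis.Analysis" "HOL-Library.Landau_Symbols"
begin

text \<open>Real topological vector spaces. The Hausdorff property is imposed separately through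
  the class \<open>t2_space\<close>.\<close>

class real_tvs = real_vector + topological_ab_group_add +
  assumes tendsto_scaleR_Pair:
    "filterlim (\<lambda>z. fst z *\<^sub>R snd z) (nhds (a *\<^sub>R x)) (nhds a \<times>\<^sub>F nhds x)"

text \<open>Powers with a real exponent \<open>a > 0\<close> on \<open>[0,\<infinity>]\<close>; in particular \<open>\<infinity>\<^sup>a = \<infinity>\<close>
  and \<open>0\<^sup>a = 0\<close>.\<close>

definition ennpowr :: "ennreal \<Rightarrow> real \<Rightarrow> ennreal" where
  "ennpowr x a = (if x = \<infinity> then \<infinity> else ennreal (enn2real x powr a))"

definition eff_domain :: "('u \<Rightarrow> ennreal) \<Rightarrow> 'u set" where
  "eff_domain \<Omega> = {u. \<Omega> u < \<infinity>}"

text \<open>The operator is a total function \<open>F\<close> together with its domain \<open>DF\<close>; the values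
  of \<open>F\<close> outside \<open>DF\<close> are never used.\<close>

definition tikh_domain :: "'u set \<Rightarrow> ('u \<Rightarrow> ennreal) \<Rightarrow> 'u set" where
  "tikh_domain DF \<Omega> = DF \<inter> eff_domain \<Omega>"

text \<open>The Tikhonov functional with data \<open>v\<close>.\<close>

definition tikhonov ::
  "('u \<Rightarrow> 'v) \<Rightarrow> ('v \<Rightarrow> 'v \<Rightarrow> ennreal) \<Rightarrow> ('u \<Rightarrow> ennreal) \<Rightarrow> real \<Rightarrow> 'v \<Rightarrow> real \<Rightarrow> 'u \<Rightarrow> ennreal"
where
  "tikhonov F S \<Omega> p v \<alpha> u = ennpowr (S (F u) v) p + ennreal \<alpha> * \<Omega> u"

text \<open>The set \<open>M\<^sub>\<alpha>(c)\<close>.\<close>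

definition sublevel ::
  "('u \<Rightarrow> 'v) \<Rightarrow> 'u set \<Rightarrow> ('v \<Rightarrow> 'v \<Rightarrow> ennreal) \<Rightarrow> ('u \<Rightarrow> ennreal) \<Rightarrow> real \<Rightarrow> 'v \<Rightarrow>
    real \<Rightarrow> real \<Rightarrow> 'u set"
where
  "sublevel F DF S \<Omega> p v0 \<alpha> c =
    {u \<in> tikh_domain DF \<Omega>. tikhonov F S \<Omega> p v0 \<alpha> u \<le> ennreal c}"

locale tikhonov_setting =
  fixes F :: "'u::{real_tvs,t2_space} \<Rightarrow> 'v::t2_space"
    and DF :: "'u set"
    and S :: "'v \<Rightarrow> 'v \<Rightarrow> ennreal"
    and \<Omega> :: "'u \<Rightarrow> ennreal"
    and p s :: real
    and v0 :: 'v
    and vd :: "real \<Rightarrow> 'v"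
  assumes p_pos: "0 < p"
    and noise: "\<And>\<delta>. \<delta> > 0 \<Longrightarrow> S (vd \<delta>) v0 \<le> ennreal \<delta> \<and> S v0 (vd \<delta>) \<le> ennreal \<delta>"
    and F_seq_continuous:
      "\<And>x l. \<lbrakk>\<And>k. x k \<in> DF; l \<in> DF; x \<longlonglongrightarrow> l\<rbrakk> \<Longrightarrow> (\<lambda>k. F (x k)) \<longlonglongrightarrow> F l"
    and DF_seq_closed:
      "\<And>x l. \<lbrakk>\<And>k. x k \<in> DF; x \<longlonglongrightarrow> l\<rbrakk> \<Longrightarrow> l \<in> DF"
    and ex_solution: "\<exists>u\<in>tikh_domain DF \<Omega>. F u = v0"
    and S_eq_0_iff: "\<And>v w. S v w = 0 \<longleftrightarrow> v = w"
    and s_ge_1: "s \<ge> 1"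
    and S_quasi_triangle:
      "\<And>v1 v2 v3. S v1 v2 \<le> ennreal s * S v1 v3 + ennreal s * S v3 v2"
    and S_seq_lsc:
      "\<And>x y v w. \<lbrakk>x \<longlonglongrightarrow> v; y \<longlonglongrightarrow> w\<rbrakk> \<Longrightarrow> S v w \<le> liminf (\<lambda>k. S (x k) (y k))"
    and S_tendsto_0_imp:
      "\<And>x v. (\<lambda>k. S (x k) v) \<longlonglongrightarrow> 0 \<Longrightarrow> x \<longlonglongrightarrow> v"
    and S_tendsto:
      "\<And>x v w. \<lbrakk>(\<lambda>k. S (x k) v) \<longlonglongrightarrow> 0; (\<lambda>k. S v (x k)) \<longlonglongrightarrow> 0; S w v < \<infinity>\<rbrakk>
         \<Longrightarrow> (\<lambda>k. S w (x k)) \<longlonglongrightarrow> S w v"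
    and \<Omega>_convex:
      "\<And>x y t. \<lbrakk>0 \<le> t; t \<le> 1\<rbrakk>
         \<Longrightarrow> \<Omega> ((1 - t) *\<^sub>R x + t *\<^sub>R y) \<le> ennreal (1 - t) * \<Omega> x + ennreal t * \<Omega> y"
    and \<Omega>_seq_lsc:
      "\<And>x l. x \<longlonglongrightarrow> l \<Longrightarrow> \<Omega> l \<le> liminf (\<lambda>k. \<Omega> (x k))"
    and sublevel_seq_compact:
      "\<And>\<alpha> c x. \<lbrakk>\<alpha> > 0; c > 0; \<And>k. x k \<in> sublevel F DF S \<Omega> p v0 \<alpha> c\<rbrakk>
         \<Longrightarrow> \<exists>l r. strict_mono (r :: nat \<Rightarrow> nat) \<and> (\<lambda>k. x (r k)) \<longlonglongrightarrow> l"

definition Omega_minimizing_solution ::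
  "('u \<Rightarrow> 'v) \<Rightarrow> 'u set \<Rightarrow> ('u \<Rightarrow> ennreal) \<Rightarrow> 'v \<Rightarrow> 'u \<Rightarrow> bool"
where
  "Omega_minimizing_solution F DF \<Omega> v0 ud \<longleftrightarrow>
    ud \<in> tikh_domain DF \<Omega> \<and> F ud = v0 \<and>
    \<Omega> ud = (INF u\<in>{u \<in> tikh_domain DF \<Omega>. F u = v0}. \<Omega> u)"

definition subdifferential ::
  "('u::real_tvs \<Rightarrow> ennreal) \<Rightarrow> 'u \<Rightarrow> ('u \<Rightarrow> real) set"
where
  "subdifferential \<Omega> u0 =
    {\<xi>. linear \<xi> \<and> continuous_on UNIV \<xi> \<and>
        (\<forall>u. enn2ereal (\<Omega> u) \<ge> enn2ereal (\<Omega> u0) + ereal (\<xi> (u - u0)))}"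

definition bregman ::
  "('u::real_vector \<Rightarrow> ennreal) \<Rightarrow> ('u \<Rightarrow> real) \<Rightarrow> 'u \<Rightarrow> 'u \<Rightarrow> ereal"
where
  "bregman \<Omega> \<xi> u u0 = enn2ereal (\<Omega> u) - enn2ereal (\<Omega> u0) - ereal (\<xi> (u - u0))"

text \<open>The distance function \<open>d\<close>. On the sublevel set the Bregman distance to \<open>ud\<close> and the
  similarity term are finite, so nothing is lost by passing to real values. The minimum is
  rendered literally as the least element of the set of values. The case distinction
  implements \<open>0\<^sup>0 = 1\<close>, since \<open>0 powr 0 = 0\<close>.\<close>

definition distance_function ::
  "('u::real_vector \<Rightarrow> 'v) \<Rightarrow> 'u set \<Rightarrow> ('v \<Rightarrow> 'v \<Rightarrow> ennreal) \<Rightarrow> ('u \<Rightarrow> ennreal) \<Rightarrow> real \<Rightarrow> 'v \<Rightarrow>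
    'u \<Rightarrow> real \<Rightarrow> ('u \<Rightarrow> real) \<Rightarrow> real \<Rightarrow> real \<Rightarrow> real \<Rightarrow> real \<Rightarrow> real \<Rightarrow> real \<Rightarrow> real"
where
  "distance_function F DF S \<Omega> p v0 ud \<kappa> \<xi> \<rho> \<alpha>b \<beta>1 \<beta>2 \<gamma> r =
    - (LEAST y. y \<in> (\<lambda>u. \<xi> (u - ud) + \<beta>1 * real_of_ereal (bregman \<Omega> \<xi> u ud)
                         + \<beta>2 * (if \<gamma> = 0 then 1 else r powr \<gamma>) * enn2real (S (F u) (F ud)) powr \<kappa>)
                   ` sublevel F DF S \<Omega> p v0 \<alpha>b (\<rho> * \<alpha>b))"

definition c_const :: "real \<Rightarrow> real" where
  "c_const p = (if p < 1 then 1 else 2 powr (p - 1))"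

text \<open>\<open>ud\<close> satisfies an approximate variational inequality with exponent \<open>\<kappa>\<close>, witnessed by
  the element \<open>\<xi>\<close> and the constants \<open>\<rho>, \<alpha>b, \<beta>1, \<beta>2, \<gamma>\<close>.\<close>

definition approx_variational_inequality ::
  "('u::real_tvs \<Rightarrow> 'v) \<Rightarrow> 'u set \<Rightarrow> ('v \<Rightarrow> 'v \<Rightarrow> ennreal) \<Rightarrow> ('u \<Rightarrow> ennreal) \<Rightarrow> real \<Rightarrow> real \<Rightarrow> 'v \<Rightarrow>
    'u \<Rightarrow> real \<Rightarrow> ('u \<Rightarrow> real) \<Rightarrow> real \<Rightarrow> real \<Rightarrow> real \<Rightarrow> real \<Rightarrow> real \<Rightarrow> bool"
where
  "approx_variational_inequality F DF S \<Omega> p s v0 ud \<kappa> \<xi> \<rho> \<alpha>b \<beta>1 \<beta>2 \<gamma> \<longleftrightarrow>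
    0 < \<kappa> \<and> \<xi> \<in> subdifferential \<Omega> ud \<and>
    ennreal (c_const p * s powr p) * \<Omega> ud < ennreal \<rho> \<and>
    0 < \<alpha>b \<and> 0 \<le> \<beta>1 \<and> \<beta>1 < 1 \<and> 0 \<le> \<beta>2 \<and> 0 \<le> \<gamma> \<and>
    (distance_function F DF S \<Omega> p v0 ud \<kappa> \<xi> \<rho> \<alpha>b \<beta>1 \<beta>2 \<gamma> \<longlongrightarrow> 0) at_top"

end

theory Submission
  imports Defs
begin

text \<open>Put \<open>r = \<Psi>\<inverse>(\<alpha>(\<delta>))\<close>. Since \<open>d(r) \<Psi>(r) = \<Phi>(r)\<^sup>p\<close>, the parameter choice says exactly
  \<open>\<Phi>(r) = \<delta>\<close>, that is \<open>r\<^sup>\<gamma> \<delta>\<^sup>\<kappa> = d(r)\<close> and \<open>\<delta>\<^sup>p / \<alpha>(\<delta>) = d(r)\<close>. Hence \<open>r \<rightarrow> \<infinity>\<close> as \<open>\<delta> \<rightarrow> 0\<close>,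
  both \<open>\<alpha>(\<delta>)\<close> and \<open>\<delta>\<^sup>p / \<alpha>(\<delta>)\<close> tend to \<open>0\<close>, and the minimizers eventually lie in the sublevel set
  over which \<open>d\<close> is defined. Inserting the minimizer into the definition of \<open>d(r)\<close> bounds the
  Bregman distance by \<open>d(r)\<close> times an expression \<open>C + K y\<^sup>\<kappa> - y\<^sup>p\<close> in the scaled residual
  \<open>y = S(F u, v\<^sup>\<delta>) / \<delta>\<close>, which is bounded because \<open>\<kappa> < p\<close>. That \<open>\<Psi>\<close> maps onto \<open>(0,\<infinity>)\<close>
  rests on the continuity of \<open>d\<close>: as a function of \<open>r\<^sup>\<gamma>\<close>, \<open>d\<close> is a maximum of affine functions
  and hence convex.\<close>

section \<open>Power inequalities and the common form of \<open>\<Psi>\<close> and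
  \<open>\<Phi>\<close>\<close>

lemma one_le_c_const: "1 \<le> c_const q"
  by (auto simp: c_const_def intro: ge_one_powr_ge_zero)

text \<open>For \<open>q \<ge> 1\<close> this is midpoint convexity of the power function. For
  \<open>q < 1\<close> the fractions \<open>a / (a + b)\<close> and \<open>b / (a + b)\<close> lie
  in the unit interval, so raising them to the power \<open>q\<close> only enlarges them, and they
  sum to 1.\<close>

lemma powr_add_le_c_const:
  fixes a b q :: real
  assumes "0 \<le> a" "0 \<le> b" "0 < q"
  shows "(a + b) powr q \<le> c_const q * (a powr q + b powr q)"
proof (cases "a = 0 \<or> b = 0")
  case True
  have "1 * (a powr q + b powr q) \<le> c_const q * (a powr q + b powr q)"
    by (intro mult_right_mono one_le_c_const) auto
  then show ?thesis using True assms by auto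
next
  case False
  then have pos: "a > 0" "b > 0" using assms by auto
  show ?thesis
  proof (cases "q < 1")
    case True
    have *: "t / (a + b) \<le> t powr q / (a + b) powr q" if "0 < t" "t \<le> a + b" for t
    proof -
      have "(t / (a + b)) powr 1 \<le> (t / (a + b)) powr q"
        using that pos True by (intro powr_mono') auto
      then show ?thesis using that by (simp add: powr_divide)
    qed
    have "1 = a / (a + b) + b / (a + b)"
      using pos by (simp flip: add_divide_distrib)
    also have "\<dots> \<le> (a powr q + b powr q) / (a + b) powr q"
      using *[of a] *[of b] pos by (simp add: add_divide_distrib)
    finally show ?thesis
      using True pos by (simp add: c_const_def field_simps)
  next
    case q: False
    have "((a + b) / 2) powr q \<le> (a powr q + b powr q) / 2"
      using convex_onD[OF powr_convex, of q "1/2" a b] q pos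
      by (simp add: field_simps)
    then show ?thesis
      using q pos by (simp add: c_const_def powr_divide powr_diff field_simps)
  qed
qed

text \<open>Covers \<open>\<Psi>\<close> and \<open>\<Phi>\<close> at once. Strictness comes from
  the factor \<open>r powr (- b)\<close> alone, so weak monotonicity of \<open>d\<close> is enough;
  surjectivity is the intermediate value theorem.\<close>

lemma
  fixes d :: "real \<Rightarrow> real" and a b :: real
  assumes pos: "\<And>r. r > 0 \<Longrightarrow> d r > 0"
    and antimono: "\<And>r r'. 0 < r \<Longrightarrow> r \<le> r' \<Longrightarrow> d r' \<le> d r"
    and ab: "0 < a" "0 < b"
  defines "f \<equiv> \<lambda>r. d r powr a * r powr (- b)"
  shows powr_decreasing_factor_less: "\<And>r r'. 0 < r \<Longrightarrow> r < r' \<Longrightarrow> f r' < f r"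
    and powr_decreasing_factor_inj_on: "inj_on f {0<..}"
    and powr_decreasing_factor_image: "continuous_on {0<..} d \<Longrightarrow> f ` {0<..} = {0<..}"
proof -
  show less: "f r' < f r" if "0 < r" "r < r'" for r r'
  proof -
    have "d r' powr a * r' powr (- b) \<le> d r powr a * r' powr (- b)"
      using that pos[of r'] antimono[of r r'] ab by (intro mult_right_mono powr_mono2) auto
    also have "\<dots> < d r powr a * r powr (- b)"
      using that pos[of r] ab by (intro mult_strict_left_mono powr_less_mono2_neg) auto
    finally show ?thesis by (simp add: f_def)
  qed
  show "inj_on f {0<..}"
    by (rule inj_onI) (metis greaterThan_iff less less_irrefl linorder_neqE)
  show "f ` {0<..} = {0<..}" if cont: "continuous_on {0<..} d"
  proof (intro equalityI subsetI)
    fix y assume "y \<in> f ` {0<..}"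
    then show "y \<in> {0<..}" using pos by (force simp: f_def)
  next
    fix y :: real assume "y \<in> {0<..}"
    then have y: "y > 0" by simp
    have d1: "d 1 powr a > 0" using pos[of 1] by simp
    \<comment> \<open>\<open>t\<close> solves the equation with \<open>d\<close> frozen at its value
      at 1. Since \<open>d\<close> is at least \<open>d 1\<close> to the left of 1 and at most
      \<open>d 1\<close> to the right, \<open>min t 1\<close> and \<open>max t 1\<close> bracket a
      solution of the true equation.\<close>
    define t where "t = (d 1 powr a / y) powr (1 / b)"
    have t: "t > 0" and tb: "d 1 powr a * t powr (- b) = y"
      using y d1 ab by (auto simp: t_def powr_powr powr_minus)
    have fy1: "y \<le> f (min t 1)"
    proof -
      have m: "0 < min t 1" "min t 1 \<le> t" "min t 1 \<le> 1" using t by auto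
      have "y = d 1 powr a * t powr (- b)" using tb by simp
      also have "\<dots> \<le> d (min t 1) powr a * (min t 1) powr (- b)"
        using m ab pos[of 1] antimono[OF m(1,3)]
        by (intro mult_mono powr_mono2 powr_mono2') (auto simp del: min_less_iff_conj)
      finally show ?thesis by (simp add: f_def)
    qed
    have fy2: "f (max t 1) \<le> y"
    proof -
      have m: "0 < max t 1" "t \<le> max t 1" "1 \<le> max t 1" by auto
      have "d (max t 1) powr a * (max t 1) powr (- b) \<le> d 1 powr a * t powr (- b)"
        using m(2) t ab less_imp_le[OF pos[OF m(1)]] antimono[OF _ m(3)]
        by (intro mult_mono powr_mono2 powr_mono2') simp_all
      then show ?thesis using tb by (simp add: f_def)
    qed
    have "\<forall>r\<in>{min t 1..max t 1}. 0 < r"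
      using t by (metis atLeastAtMost_iff less_le_trans min_less_iff_conj zero_less_one)
    then have "continuous_on {min t 1..max t 1} f"
      unfolding f_def
      by (intro continuous_on_mult continuous_on_powr continuous_on_const continuous_on_id
          continuous_on_subset[OF cont]) (use pos in \<open>auto dest!: bspec simp: less_imp_neq[THEN not_sym]\<close>)
    then obtain r where "min t 1 \<le> r" "f r = y"
      using IVT2'[of f "max t 1" y "min t 1", OF fy2 fy1] order_trans[OF min.cobounded1 max.cobounded1]
      by blast
    moreover have "0 < min t 1" using t by simp
    ultimately show "y \<in> f ` {0<..}" by (metis greaterThan_iff image_eqI less_le_trans)
  qed
qed

section \<open>Sequential lower semicontinuity and the direct method\<close>

text \<open>The epsilon form stays within the reals and makes sums immediate. Sequence and limit
  both range over \<open>M\<close>, so functions obtained through \<open>enn2real\<close> are tested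
  only where the underlying values are finite.\<close>

definition seq_lsc_on :: "'a::topological_space set \<Rightarrow> ('a \<Rightarrow> real) \<Rightarrow> bool" where
  "seq_lsc_on M f \<longleftrightarrow>
    (\<forall>x l e. (\<forall>k. x k \<in> M) \<longrightarrow> l \<in> M \<longrightarrow> x \<longlonglongrightarrow> l \<longrightarrow> 0 < e \<longrightarrow>
      (\<forall>\<^sub>F k in sequentially. f l - e < f (x k)))"

lemma seq_lsc_onI:
  assumes "\<And>x l e. \<lbrakk>\<And>k. x k \<in> M; l \<in> M; x \<longlonglongrightarrow> l; 0 < e\<rbrakk> \<Longrightarrow>
    \<forall>\<^sub>F k in sequentially. f l - e < f (x k)"
  shows "seq_lsc_on M f"
  using assms by (auto simp: seq_lsc_on_def)

lemma seq_lsc_onD: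
  assumes "seq_lsc_on M f" "\<And>k. x k \<in> M" "l \<in> M" "x \<longlonglongrightarrow> l" "0 < e"
  shows "\<forall>\<^sub>F k in sequentially. f l - e < f (x k)"
  using assms by (auto simp: seq_lsc_on_def)

lemma seq_lsc_on_add:
  assumes "seq_lsc_on M f" "seq_lsc_on M g"
  shows "seq_lsc_on M (\<lambda>u. f u + g u)"
proof (rule seq_lsc_onI)
  fix x l and e :: real
  assume x: "\<And>k. x k \<in> M" "l \<in> M" "x \<longlonglongrightarrow> l" and e: "0 < e"
  have "\<forall>\<^sub>F k in sequentially. f l - e / 2 < f (x k)"
    "\<forall>\<^sub>F k in sequentially. g l - e / 2 < g (x k)"
    using e by (auto intro: seq_lsc_onD[OF assms(1) x] seq_lsc_onD[OF assms(2) x])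
  then show "\<forall>\<^sub>F k in sequentially. f l + g l - e < f (x k) + g (x k)"
    by eventually_elim linarith
qed

lemma seq_lsc_on_cmult:
  assumes "seq_lsc_on M f" "0 \<le> c"
  shows "seq_lsc_on M (\<lambda>u. c * f u)"
proof (cases "c = 0")
  case True
  then show ?thesis by (auto intro: seq_lsc_onI)
next
  case False
  then have c: "c > 0" using assms by simp
  show ?thesis
  proof (rule seq_lsc_onI)
    fix x l and e :: real
    assume x: "\<And>k. x k \<in> M" "l \<in> M" "x \<longlonglongrightarrow> l" and e: "0 < e"
    have "\<forall>\<^sub>F k in sequentially. f l - e / c < f (x k)"
      using e c x by (intro seq_lsc_onD[OF assms(1)]) auto
    then show "\<forall>\<^sub>F k in sequentially. c * f l - e < c * f (x k)"
      by eventually_elim (use c in \<open>simp add: field_simps\<close>)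
  qed
qed

lemma seq_lsc_on_continuous:
  fixes f :: "'a::topological_space \<Rightarrow> real"
  assumes "continuous_on UNIV f"
  shows "seq_lsc_on M f"
proof (rule seq_lsc_onI)
  fix x :: "nat \<Rightarrow> 'a" and l and e :: real
  assume "x \<longlonglongrightarrow> l" "0 < e"
  then have "(\<lambda>k. f (x k)) \<longlonglongrightarrow> f l"
    using assms by (auto intro: continuous_on_tendsto_compose)
  then show "\<forall>\<^sub>F k in sequentially. f l - e < f (x k)"
    using \<open>0 < e\<close> by (intro order_tendstoD(1)) auto
qed

text \<open>Direct method: a minimizing sequence has a subsequence with limit in \<open>M\<close>,
  and semicontinuity bounds the value there by the infimum. The infimum is formed in
  \<open>ereal\<close> because boundedness below is not known beforehand.\<close>

lemma seq_lsc_on_attains_min: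
  fixes f :: "'a::topological_space \<Rightarrow> real"
  assumes "M \<noteq> {}" and lsc: "seq_lsc_on M f"
    and compact: "\<And>x. (\<And>k. x k \<in> M) \<Longrightarrow>
      \<exists>l\<in>M. \<exists>r. strict_mono (r :: nat \<Rightarrow> nat) \<and> (\<lambda>k. x (r k)) \<longlonglongrightarrow> l"
  obtains m where "m \<in> M" "\<And>u. u \<in> M \<Longrightarrow> f m \<le> f u"
proof -
  define I where "I = (INF u\<in>M. ereal (f u))"
  have "\<exists>g :: nat \<Rightarrow> ereal. range g \<subseteq> (\<lambda>u. ereal (f u)) ` M \<and> g \<longlonglongrightarrow> I"
    using Inf_as_limit[of "(\<lambda>u. ereal (f u)) ` M"] \<open>M \<noteq> {}\<close> by (auto simp: I_def)
  then obtain g :: "nat \<Rightarrow> ereal" where g: "range g \<subseteq> (\<lambda>u. ereal (f u)) ` M" "g \<longlonglongrightarrow> I"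
    by blast
  then have "\<forall>k. \<exists>u\<in>M. g k = ereal (f u)" by blast
  then obtain x where x: "\<And>k. x k \<in> M" "\<And>k. g k = ereal (f (x k))" by metis
  from compact[of x] x(1) obtain l r where l: "l \<in> M" and r: "strict_mono (r :: nat \<Rightarrow> nat)"
    and lim: "(\<lambda>k. x (r k)) \<longlonglongrightarrow> l" by blast
  have gr: "(\<lambda>k. g (r k)) \<longlonglongrightarrow> I"
    using LIMSEQ_subseq_LIMSEQ[OF g(2) r] by (simp add: o_def)
  have "f l \<le> f u + e" if "u \<in> M" "0 < e" for u e
  proof -
    have "\<forall>\<^sub>F k in sequentially. f l - e < f (x (r k))"
      using x(1) l lim that(2) by (intro seq_lsc_onD[OF lsc]) auto
    then have "\<forall>\<^sub>F k in sequentially. ereal (f l - e) \<le> g (r k)"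
      by eventually_elim (simp add: x(2))
    then have "ereal (f l - e) \<le> I"
      by (intro tendsto_lowerbound[OF gr]) auto
    also have "I \<le> ereal (f u)"
      unfolding I_def using that by (intro INF_lower)
    finally show ?thesis by simp
  qed
  then have "f l \<le> f u" if "u \<in> M" for u
    using that by (meson field_le_epsilon)
  with l show ?thesis using that by blast
qed

text \<open>A nonnegative threshold below \<open>enn2real (h l) powr q\<close> becomes, by taking
  \<open>q\<close>-th roots, a threshold below \<open>h l\<close>, which the \<open>liminf\<close>
  hypothesis passes on to almost all terms. A negative threshold is beaten by every power.\<close>

lemma enn2real_powr_seq_lsc_on:
  fixes h :: "'a::topological_space \<Rightarrow> ennreal"
  assumes lsc: "\<And>x l. (\<And>k. x k \<in> M) \<Longrightarrow> l \<in> M \<Longrightarrow> x \<longlonglongrightarrow> l \<Longrightarrow> h l \<le> liminf (\<lambda>k. h (x k))"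
    and fin: "\<And>u. u \<in> M \<Longrightarrow> h u < \<infinity>" and q: "0 < q"
  shows "seq_lsc_on M (\<lambda>u. enn2real (h u) powr q)"
proof (rule seq_lsc_onI)
  fix x l and e :: real
  assume x: "\<And>k. x k \<in> M" "l \<in> M" "x \<longlonglongrightarrow> l" and e: "0 < e"
  define y where "y = enn2real (h l) powr q - e"
  show "\<forall>\<^sub>F k in sequentially. enn2real (h l) powr q - e < enn2real (h (x k)) powr q"
  proof (cases "y < 0")
    case True
    then have "enn2real (h l) powr q - e < enn2real (h (x k)) powr q" for k
      unfolding y_def by (rule less_le_trans) auto
    then show ?thesis by simp
  next
    case False
    have "y powr (1 / q) < (enn2real (h l) powr q) powr (1 / q)"
      using False e q by (intro powr_less_mono2) (auto simp: y_def)
    then have "ennreal (y powr (1 / q)) < ennreal (enn2real (h l))"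
      using q by (simp add: powr_powr ennreal_less_iff)
    then have "ennreal (y powr (1 / q)) < h l"
      using fin[OF x(2)] by simp
    then have "\<forall>\<^sub>F k in sequentially. ennreal (y powr (1 / q)) < h (x k)"
      using lsc[OF x] by (simp add: le_Liminf_iff)
    then show ?thesis
    proof eventually_elim
      case (elim k)
      then have "ennreal (y powr (1 / q)) < ennreal (enn2real (h (x k)))"
        using fin[OF x(1)] by simp
      then have "(y powr (1 / q)) powr q < enn2real (h (x k)) powr q"
        using q by (intro powr_less_mono2) (auto simp: ennreal_less_iff)
      then show ?case using q False by (simp add: powr_powr y_def)
    qed
  qed
qed

section \<open>Real-valued forms of the functional, the sublevel sets and the Bregman
  distance\<close>

lemma tikhonov_eq_ennreal:
  assumes "S (F u) v < \<infinity>" "\<Omega> u < \<infinity>" "0 \<le> \<alpha>"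
  shows "tikhonov F S \<Omega> p v \<alpha> u = ennreal (enn2real (S (F u) v) powr p + \<alpha> * enn2real (\<Omega> u))"
proof -
  have "ennreal \<alpha> * \<Omega> u = ennreal (\<alpha> * enn2real (\<Omega> u))"
    using assms by (simp add: ennreal_mult)
  then show ?thesis using assms by (simp add: tikhonov_def ennpowr_def ennreal_plus)
qed

lemma tikhonov_finite_imp:
  assumes "tikhonov F S \<Omega> p v \<alpha> u < \<infinity>"
  shows "S (F u) v < \<infinity>"
  using assms by (cases "S (F u) v = \<infinity>") (simp_all add: tikhonov_def ennpowr_def less_top)

lemma mem_sublevel_iff:
  assumes "0 \<le> \<alpha>" "0 \<le> c"
  shows "u \<in> sublevel F DF S \<Omega> p v \<alpha> c \<longleftrightarrow> u \<in> DF \<and> \<Omega> u < \<infinity> \<and> S (F u) v < \<infinity> \<and>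
    enn2real (S (F u) v) powr p + \<alpha> * enn2real (\<Omega> u) \<le> c"
proof -
  have "S (F u) v < \<infinity>" if "tikhonov F S \<Omega> p v \<alpha> u \<le> ennreal c"
    using le_less_trans[OF that, of \<infinity>] tikhonov_finite_imp by simp
  moreover have "tikhonov F S \<Omega> p v \<alpha> u \<le> ennreal c \<longleftrightarrow>
      enn2real (S (F u) v) powr p + \<alpha> * enn2real (\<Omega> u) \<le> c" if "\<Omega> u < \<infinity>" "S (F u) v < \<infinity>"
    using assms that tikhonov_eq_ennreal[of S F u v \<Omega> \<alpha> p] by (simp del: ennreal_plus)
  ultimately show ?thesis
    unfolding sublevel_def tikh_domain_def eff_domain_def by blast
qed

lemma real_of_ereal_bregman:
  assumes "\<Omega> u < \<infinity>" "\<Omega> u0 < \<infinity>"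
  shows "real_of_ereal (bregman \<Omega> \<xi> u u0) = enn2real (\<Omega> u) - enn2real (\<Omega> u0) - \<xi> (u - u0)"
proof -
  have "enn2ereal (\<Omega> w) = ereal (enn2real (\<Omega> w))" if "\<Omega> w < \<infinity>" for w
    using that by (metis enn2ereal_ennreal enn2real_nonneg ennreal_enn2real infinity_ennreal_def)
  then show ?thesis using assms by (simp add: bregman_def)
qed

lemma real_of_ereal_bregman_nonneg:
  assumes "\<xi> \<in> subdifferential \<Omega> u0" "\<Omega> u < \<infinity>" "\<Omega> u0 < \<infinity>"
  shows "0 \<le> real_of_ereal (bregman \<Omega> \<xi> u u0)"
proof -
  have "enn2ereal (\<Omega> w) = ereal (enn2real (\<Omega> w))" if "\<Omega> w < \<infinity>" for w
    using that by (metis enn2ereal_ennreal enn2real_nonneg ennreal_enn2real infinity_ennreal_def)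
  then have "enn2real (\<Omega> u0) + \<xi> (u - u0) \<le> enn2real (\<Omega> u)"
    using assms by (auto simp: subdifferential_def dest!: spec[of _ u])
  then show ?thesis using assms by (simp add: real_of_ereal_bregman)
qed


section \<open>Absorption of lower powers, continuity by convexity, bounds at limits\<close>

text \<open>A Young-type absorption, split at \<open>K = y powr (p - q)\<close>: for larger
  \<open>y\<close> the higher power dominates, for smaller \<open>y\<close> the factor
  \<open>y powr q\<close> is at most \<open>K powr (q / (p - q))\<close>.\<close>

lemma powr_le_powr_add_const:
  fixes K y p q :: real
  assumes "0 \<le> K" "0 \<le> y" "0 < q" "q < p"
  shows "K * y powr q \<le> y powr p + K * K powr (q / (p - q))"
proof (cases "y = 0 \<or> K \<le> y powr (p - q)")
  case True
  have "K * y powr q \<le> y powr p"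
  proof (cases "y = 0")
    case False
    with True have "K * y powr q \<le> y powr (p - q) * y powr q"
      by (intro mult_right_mono) auto
    then show ?thesis by (simp flip: powr_add)
  qed simp
  moreover have "0 \<le> K * K powr (q / (p - q))"
    using assms by simp
  ultimately show ?thesis by linarith
next
  case False
  then have "(y powr (p - q)) powr (q / (p - q)) \<le> K powr (q / (p - q))"
    using assms by (intro powr_mono2) auto
  then have "K * y powr q \<le> K * K powr (q / (p - q))"
    using assms by (intro mult_left_mono) (simp_all add: powr_powr)
  then show ?thesis using powr_ge_zero[of y p] by linarith
qed

text \<open>A maximum of affine functions is convex, and a convex function on an open interval is
  continuous.\<close>

lemma continuous_on_attained_sup_affine:
  fixes f :: "real \<Rightarrow> real" and A B :: "'a \<Rightarrow> real"
  assumes "\<And>t. 0 < t \<Longrightarrow> \<exists>m\<in>M. f t = A m + t * B m"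
    and "\<And>t u. 0 < t \<Longrightarrow> u \<in> M \<Longrightarrow> A u + t * B u \<le> f t"
  shows "continuous_on {0<..} f"
proof (intro convex_on_continuous convex_onI)
  fix t x y :: real
  assume t: "0 < t" "t < 1" and x: "x \<in> {0<..}" and y: "y \<in> {0<..}"
  then have "0 < (1 - t) * x + t * y" by (intro add_pos_pos mult_pos_pos) auto
  then obtain m where m: "m \<in> M" "f ((1 - t) * x + t * y) = A m + ((1 - t) * x + t * y) * B m"
    using assms(1) by blast
  note m(2)
  also have "\<dots> = (1 - t) * (A m + x * B m) + t * (A m + y * B m)"
    by (simp add: algebra_simps)
  also have "\<dots> \<le> (1 - t) * f x + t * f y"
    using assms(2)[of x m] assms(2)[of y m] m(1) x y t
    by (intro add_mono mult_left_mono) auto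
  finally show "f ((1 - t) *\<^sub>R x + t *\<^sub>R y) \<le> (1 - t) * f x + t * f y" by simp
qed auto

lemma lsc_le_bound:
  fixes h :: "'a \<Rightarrow> ennreal"
  assumes "h l \<le> liminf (\<lambda>k. h (x k))" "\<And>k. h (x k) \<le> C"
  shows "h l \<le> C"
proof -
  have "liminf (\<lambda>k. h (x k)) \<le> liminf (\<lambda>k. C)"
    using assms(2) by (intro Liminf_mono) simp
  then show ?thesis using assms(1) by (simp add: Liminf_const)
qed

section \<open>Compactness, attainment of the minimum and estimates for minimizers\<close>

context tikhonov_setting
begin

lemma Omega_seq_lsc_on:
  assumes "\<And>u. u \<in> N \<Longrightarrow> \<Omega> u < \<infinity>"
  shows "seq_lsc_on N (\<lambda>u. enn2real (\<Omega> u))"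
  using enn2real_powr_seq_lsc_on[of N \<Omega> 1] assms \<Omega>_seq_lsc by simp

lemma S_F_seq_lsc_on:
  assumes "N \<subseteq> DF" "\<And>u. u \<in> N \<Longrightarrow> S (F u) v < \<infinity>" "0 < q"
  shows "seq_lsc_on N (\<lambda>u. enn2real (S (F u) v) powr q)"
proof (rule enn2real_powr_seq_lsc_on)
  fix x l assume "\<And>k. x k \<in> N" "l \<in> N" "x \<longlonglongrightarrow> l"
  then have "(\<lambda>k. F (x k)) \<longlonglongrightarrow> F l"
    using assms(1) by (intro F_seq_continuous) auto
  then show "S (F l) v \<le> liminf (\<lambda>k. S (F (x k)) v)"
    by (intro S_seq_lsc) auto
qed (use assms in auto)

text \<open>The compactness assumption yields a limit somewhere in the space; semicontinuity of both
  terms places it in the same sublevel set.\<close>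

lemma sublevel_seq_compact_closed:
  assumes "0 < \<alpha>" "0 < c" and x: "\<And>k. x k \<in> sublevel F DF S \<Omega> p v0 \<alpha> c"
  shows "\<exists>l\<in>sublevel F DF S \<Omega> p v0 \<alpha> c. \<exists>r. strict_mono (r :: nat \<Rightarrow> nat) \<and> (\<lambda>k. x (r k)) \<longlonglongrightarrow> l"
proof -
  let ?T = "\<lambda>u. enn2real (S (F u) v0) powr p + \<alpha> * enn2real (\<Omega> u)"
  obtain l r where r: "strict_mono (r :: nat \<Rightarrow> nat)" and lim: "(\<lambda>k. x (r k)) \<longlonglongrightarrow> l"
    using sublevel_seq_compact[of \<alpha> c x] assms by blast
  define y where "y k = x (r k)" for k
  have y: "y k \<in> DF" "\<Omega> (y k) < \<infinity>" "S (F (y k)) v0 < \<infinity>" "?T (y k) \<le> c" for k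
    using x[of "r k"] assms by (auto simp: mem_sublevel_iff y_def)
  have yl: "y \<longlonglongrightarrow> l" using lim by (simp add: y_def[abs_def])
  have l: "l \<in> DF" using DF_seq_closed[OF y(1) yl] .
  \<comment> \<open>Uniform bounds on the two terms separately make both finite at \<open>l\<close>;
    only then can the real-valued functional be evaluated there.\<close>
  have "\<Omega> (y k) \<le> ennreal (c / \<alpha>)" for k
  proof -
    have "\<alpha> * enn2real (\<Omega> (y k)) \<le> c"
      using y(4)[of k] powr_ge_zero[of "enn2real (S (F (y k)) v0)" p] by linarith
    then have "ennreal (enn2real (\<Omega> (y k))) \<le> ennreal (c / \<alpha>)"
      using assms by (intro ennreal_leI) (simp add: field_simps)
    then show ?thesis using y(2)[of k] by simp
  qed
  then have "\<Omega> l \<le> ennreal (c / \<alpha>)"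
    using \<Omega>_seq_lsc[OF yl] by (rule lsc_le_bound[rotated])
  then have \<Omega>l: "\<Omega> l < \<infinity>" by (simp add: le_less_trans)
  have "S (F (y k)) v0 \<le> ennreal (c powr (1 / p))" for k
  proof -
    have "enn2real (S (F (y k)) v0) powr p \<le> c"
      using y(4)[of k] assms by (smt (verit) enn2real_nonneg mult_nonneg_nonneg)
    then have "(enn2real (S (F (y k)) v0) powr p) powr (1 / p) \<le> c powr (1 / p)"
      using p_pos by (intro powr_mono2) auto
    then have "ennreal (enn2real (S (F (y k)) v0)) \<le> ennreal (c powr (1 / p))"
      using p_pos by (intro ennreal_leI) (simp add: powr_powr)
    then show ?thesis using y(3)[of k] by (simp only: infinity_ennreal_def ennreal_enn2real)
  qed
  moreover have "S (F l) v0 \<le> liminf (\<lambda>k. S (F (y k)) v0)"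
    using F_seq_continuous[OF y(1) l yl] by (intro S_seq_lsc) auto
  ultimately have "S (F l) v0 \<le> ennreal (c powr (1 / p))"
    using lsc_le_bound[of "\<lambda>u. S (F u) v0" l y] by blast
  then have Sl: "S (F l) v0 < \<infinity>" by (simp add: le_less_trans)
  \<comment> \<open>\<open>N\<close> contains the sequence and, by the finiteness just shown, also
    \<open>l\<close>, whose membership in the sublevel set is still open.\<close>
  define N where "N = {u \<in> DF. \<Omega> u < \<infinity> \<and> S (F u) v0 < \<infinity>}"
  have lsc: "seq_lsc_on N ?T"
    using assms p_pos
    by (intro seq_lsc_on_add seq_lsc_on_cmult Omega_seq_lsc_on S_F_seq_lsc_on) (auto simp: N_def)
  have "?T l \<le> c + e" if "0 < e" for e
  proof -
    have "\<forall>\<^sub>F k in sequentially. ?T l - e < ?T (y k)"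
      using y l \<Omega>l Sl yl that by (intro seq_lsc_onD[OF lsc]) (auto simp: N_def)
    then obtain k where "?T l - e < ?T (y k)"
      by (meson eventually_happens' sequentially_bot)
    then show ?thesis using y(4)[of k] by linarith
  qed
  then have "?T l \<le> c" by (rule field_le_epsilon)
  then have "l \<in> sublevel F DF S \<Omega> p v0 \<alpha> c"
    using assms l \<Omega>l Sl by (simp add: mem_sublevel_iff)
  then show ?thesis using r lim by blast
qed

text \<open>The \<open>LEAST\<close> in the definition is meaningful only if a minimum exists, which
  the direct method provides. Separating \<open>A\<close> from \<open>B\<close> displays
  \<open>d r\<close> as a maximum of functions affine in the weight \<open>w r\<close>.\<close>

lemma distance_function_attained:
  fixes ud u :: 'u and \<gamma> r :: real
  assumes ud: "ud \<in> DF" "F ud = v0" "\<Omega> ud < \<infinity>" "enn2real (\<Omega> ud) \<le> \<rho>"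
    and \<xi>: "\<xi> \<in> subdifferential \<Omega> ud"
    and pos: "0 < \<alpha>b" "0 < \<rho>" "0 < \<kappa>" and \<beta>: "0 \<le> \<beta>1" "\<beta>1 \<le> 1" "0 \<le> \<beta>2"
  defines "M \<equiv> sublevel F DF S \<Omega> p v0 \<alpha>b (\<rho> * \<alpha>b)"
    and "A \<equiv> \<lambda>u. - \<xi> (u - ud) - \<beta>1 * real_of_ereal (bregman \<Omega> \<xi> u ud)"
    and "B \<equiv> \<lambda>u. - \<beta>2 * enn2real (S (F u) v0) powr \<kappa>"
    and "w \<equiv> \<lambda>r. if \<gamma> = 0 then 1 else r powr \<gamma>"
    and "d \<equiv> distance_function F DF S \<Omega> p v0 ud \<kappa> \<xi> \<rho> \<alpha>b \<beta>1 \<beta>2 \<gamma>"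
  shows "\<exists>m\<in>M. d r = A m + w r * B m"
    and "u \<in> M \<Longrightarrow> A u + w r * B u \<le> d r"
proof -
  have M: "u \<in> DF" "\<Omega> u < \<infinity>" "S (F u) v0 < \<infinity>" if "u \<in> M" for u
    using that pos by (auto simp: M_def mem_sublevel_iff)
  have w: "0 \<le> w r" by (simp add: w_def)
  have lin: "linear \<xi>" and cont: "continuous_on UNIV \<xi>"
    using \<xi> by (auto simp: subdifferential_def)
  define f where "f u = - A u - w r * B u" for u
  \<comment> \<open>Expanding the Bregman distance merges the linear terms into
    \<open>(1 - \<beta>1) * \<xi> u\<close>, so that only nonnegative multiples of lower
    semicontinuous functions and a constant remain.\<close>
  have f_eq: "f u = (1 - \<beta>1) * \<xi> u + \<beta>1 * enn2real (\<Omega> u)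
      + (\<beta>2 * w r) * enn2real (S (F u) v0) powr \<kappa>
      + (- (1 - \<beta>1) * \<xi> ud - \<beta>1 * enn2real (\<Omega> ud))" if "u \<in> M" for u
    using M(2)[OF that] ud lin
    by (simp add: f_def A_def B_def real_of_ereal_bregman linear_diff algebra_simps)
  have "seq_lsc_on M (\<lambda>u. (1 - \<beta>1) * \<xi> u + \<beta>1 * enn2real (\<Omega> u)
      + (\<beta>2 * w r) * enn2real (S (F u) v0) powr \<kappa>
      + (- (1 - \<beta>1) * \<xi> ud - \<beta>1 * enn2real (\<Omega> ud)))"
    using M \<beta> pos w
    by (intro seq_lsc_on_add seq_lsc_on_cmult Omega_seq_lsc_on S_F_seq_lsc_on
        seq_lsc_on_continuous[OF cont] seq_lsc_on_continuous[OF continuous_on_const]) auto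
  then have "seq_lsc_on M f"
    using f_eq by (simp add: seq_lsc_on_def)
  moreover have "S v0 v0 = 0" by (simp add: S_eq_0_iff)
  then have "ud \<in> M"
    using ud pos by (simp add: M_def mem_sublevel_iff)
  then have "M \<noteq> {}" by blast
  ultimately obtain m where m: "m \<in> M" "\<And>u. u \<in> M \<Longrightarrow> f m \<le> f u"
    using sublevel_seq_compact_closed[of \<alpha>b "\<rho> * \<alpha>b"] pos
    by (auto simp: M_def intro: seq_lsc_on_attains_min)
  have "d r = - (LEAST y. y \<in> f ` M)"
    by (simp add: d_def distance_function_def f_def A_def B_def w_def M_def ud mult_ac add_ac)
  also have "(LEAST y. y \<in> f ` M) = f m"
    using m by (intro Least_equality) auto
  finally have d: "d r = - f m" .
  show "\<exists>m\<in>M. d r = A m + w r * B m"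
    using m(1) d by (intro bexI[of _ m]) (simp_all add: f_def)
  show "A u + w r * B u \<le> d r" if "u \<in> M"
    using m(2)[OF that] d by (simp add: f_def)
qed

text \<open>The minimizer is compared with \<open>ud\<close>, whose residual is at most
  \<open>\<delta>\<close> by the noise bound from \<open>v0\<close> to \<open>vd \<delta>\<close>.
  The opposite noise bound enters through the quasi-triangle inequality with intermediate point
  \<open>vd \<delta>\<close>.\<close>

lemma minimizer_estimates:
  fixes u ud :: 'u
  assumes \<delta>: "0 < \<delta>" and \<alpha>: "0 < \<alpha>" and ud: "ud \<in> tikh_domain DF \<Omega>" "F ud = v0"
    and min: "is_arg_min (tikhonov F S \<Omega> p (vd \<delta>) \<alpha>) (\<lambda>u. u \<in> tikh_domain DF \<Omega>) u"
  defines "x \<equiv> enn2real (S (F u) (vd \<delta>))"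
  shows "u \<in> tikh_domain DF \<Omega>" and "S (F u) v0 < \<infinity>"
    and "x powr p + \<alpha> * enn2real (\<Omega> u) \<le> \<delta> powr p + \<alpha> * enn2real (\<Omega> ud)"
    and "enn2real (S (F u) v0) \<le> s * (x + \<delta>)"
proof -
  let ?v = "vd \<delta>"
  show u: "u \<in> tikh_domain DF \<Omega>" using min by (simp add: is_arg_min_def)
  then have \<Omega>u: "\<Omega> u < \<infinity>" and \<Omega>ud: "\<Omega> ud < \<infinity>"
    using ud by (auto simp: tikh_domain_def eff_domain_def)
  have noise1: "S ?v v0 \<le> ennreal \<delta>" and noise2: "S v0 ?v \<le> ennreal \<delta>"
    using noise[OF \<delta>] by auto
  have "S v0 ?v < \<infinity>" using noise2 by (simp add: le_less_trans)
  moreover have "enn2real (S v0 ?v) \<le> \<delta>"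
    using noise2 \<delta> by (simp add: enn2real_leI)
  then have "enn2real (S v0 ?v) powr p \<le> \<delta> powr p"
    using p_pos by (intro powr_mono2) auto
  ultimately have "tikhonov F S \<Omega> p ?v \<alpha> ud \<le> ennreal (\<delta> powr p + \<alpha> * enn2real (\<Omega> ud))"
    using \<Omega>ud \<alpha> tikhonov_eq_ennreal[of S F ud ?v \<Omega> \<alpha> p] ud(2) by (simp add: ennreal_leI del: ennreal_plus)
  moreover have "tikhonov F S \<Omega> p ?v \<alpha> u \<le> tikhonov F S \<Omega> p ?v \<alpha> ud"
    using min ud(1) by (auto simp: is_arg_min_def not_less)
  ultimately have T: "tikhonov F S \<Omega> p ?v \<alpha> u \<le> ennreal (\<delta> powr p + \<alpha> * enn2real (\<Omega> ud))"
    by (rule order_trans[rotated])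
  then have Sx: "S (F u) ?v < \<infinity>"
    using tikhonov_finite_imp[of F S \<Omega> p ?v \<alpha> u] le_less_trans[OF T, of \<infinity>] by simp
  show "x powr p + \<alpha> * enn2real (\<Omega> u) \<le> \<delta> powr p + \<alpha> * enn2real (\<Omega> ud)"
    using T \<alpha> tikhonov_eq_ennreal[of S F u ?v \<Omega> \<alpha> p] Sx \<Omega>u by (simp add: x_def del: ennreal_plus)
  have "S (F u) v0 \<le> ennreal s * S (F u) ?v + ennreal s * S ?v v0"
    by (rule S_quasi_triangle)
  also have "\<dots> \<le> ennreal s * ennreal x + ennreal s * ennreal \<delta>"
    using Sx noise1 by (intro add_mono mult_left_mono) (auto simp: x_def)
  also have "\<dots> = ennreal (s * (x + \<delta>))"
    using s_ge_1 \<delta> by (simp add: x_def ennreal_mult ennreal_plus[symmetric] distrib_left[symmetric] del: ennreal_plus)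
  finally have S: "S (F u) v0 \<le> ennreal (s * (x + \<delta>))" .
  then show "S (F u) v0 < \<infinity>" by (simp add: le_less_trans)
  show "enn2real (S (F u) v0) \<le> s * (x + \<delta>)"
    using S s_ge_1 \<delta> by (intro enn2real_leI) (auto simp: x_def)
qed

lemma S_powr_le_of_quasi_triangle:
  fixes \<sigma> x \<delta> q :: real
  assumes "\<sigma> \<le> s * (x + \<delta>)" "0 \<le> \<sigma>" "0 \<le> x" "0 \<le> \<delta>" "0 < q"
  shows "\<sigma> powr q \<le> c_const q * s powr q * (x powr q + \<delta> powr q)"
proof -
  have "\<sigma> powr q \<le> (s * (x + \<delta>)) powr q"
    using assms by (intro powr_mono2) auto
  also have "\<dots> = s powr q * (x + \<delta>) powr q"
    using s_ge_1 assms by (simp add: powr_mult)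
  also have "\<dots> \<le> s powr q * (c_const q * (x powr q + \<delta> powr q))"
    using assms by (intro mult_left_mono powr_add_le_c_const) auto
  finally show ?thesis by (simp add: mult_ac)
qed

lemma one_le_c_const_mult: "1 \<le> c_const q * s powr q" if "0 < q"
proof -
  have "1 \<le> s powr q"
    using s_ge_1 that by (simp add: ge_one_powr_ge_zero)
  then show ?thesis using mult_mono[of 1 "c_const q" 1 "s powr q"] one_le_c_const[of q] by simp
qed

text \<open>Comparison with \<open>ud\<close> bounds the exact-data functional with parameter
  \<open>\<alpha>\<close> by \<open>\<alpha> * \<rho>\<close>. Scaling by
  \<open>\<alpha>b / \<alpha> \<ge> 1\<close> turns the penalty weight into \<open>\<alpha>b\<close>
  and only enlarges the residual term.\<close>

lemma minimizer_in_sublevel: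
  fixes u ud :: 'u
  assumes \<delta>: "0 < \<delta>" and \<alpha>: "0 < \<alpha>" "\<alpha> \<le> \<alpha>b"
    and ud: "ud \<in> tikh_domain DF \<Omega>" "F ud = v0"
    and min: "is_arg_min (tikhonov F S \<Omega> p (vd \<delta>) \<alpha>) (\<lambda>u. u \<in> tikh_domain DF \<Omega>) u"
    and \<rho>: "c_const p * s powr p * (2 * (\<delta> powr p / \<alpha>) + enn2real (\<Omega> ud)) \<le> \<rho>"
  shows "u \<in> sublevel F DF S \<Omega> p v0 \<alpha>b (\<rho> * \<alpha>b)"
proof -
  define C where "C = c_const p * s powr p"
  define x where "x = enn2real (S (F u) (vd \<delta>))"
  note est = minimizer_estimates[OF \<delta> \<alpha>(1) ud min, folded x_def]
  have C: "1 \<le> C" using one_le_c_const_mult[OF p_pos] by (simp add: C_def)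
  have "0 \<le> x" by (simp add: x_def)
  let ?\<omega> = "enn2real (\<Omega> u)" and ?\<sigma> = "enn2real (S (F u) v0)"
  have "?\<sigma> powr p \<le> C * (x powr p + \<delta> powr p)"
    unfolding C_def using est(4) \<open>0 \<le> x\<close> \<delta> p_pos by (intro S_powr_le_of_quasi_triangle) auto
  moreover have "1 * (\<alpha> * ?\<omega>) \<le> C * (\<alpha> * ?\<omega>)"
    using C \<alpha> by (intro mult_right_mono) auto
  ultimately have "?\<sigma> powr p + \<alpha> * ?\<omega> \<le> C * (x powr p + \<alpha> * ?\<omega> + \<delta> powr p)"
    by (simp add: algebra_simps)
  also have "\<dots> \<le> C * (2 * \<delta> powr p + \<alpha> * enn2real (\<Omega> ud))"
    using C est(3) by (intro mult_left_mono) auto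
  also have "\<dots> = \<alpha> * (C * (2 * (\<delta> powr p / \<alpha>) + enn2real (\<Omega> ud)))"
    using \<alpha> by (simp add: field_simps)
  also have "\<dots> \<le> \<alpha> * \<rho>"
    using \<rho> \<alpha> by (intro mult_left_mono) (auto simp: C_def)
  finally have "(\<alpha>b / \<alpha>) * (?\<sigma> powr p + \<alpha> * ?\<omega>) \<le> (\<alpha>b / \<alpha>) * (\<alpha> * \<rho>)"
    using \<alpha> by (intro mult_left_mono) auto
  moreover have "1 * ?\<sigma> powr p \<le> (\<alpha>b / \<alpha>) * ?\<sigma> powr p"
    using \<alpha> by (intro mult_right_mono) auto
  ultimately have "?\<sigma> powr p + \<alpha>b * ?\<omega> \<le> \<rho> * \<alpha>b"
    using \<alpha> by (simp add: distrib_left mult_ac)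
  moreover have "0 \<le> \<rho>"
    using order_trans[OF _ \<rho>] C \<alpha> by (simp add: C_def)
  ultimately show ?thesis
    using est(1,2) \<alpha> by (simp add: mem_sublevel_iff tikh_domain_def eff_domain_def)
qed

text \<open>The real-number core of the rate, with \<open>D\<close> for \<open>d r\<close>,
  \<open>W\<close> for \<open>r powr \<gamma>\<close> and \<open>q\<close> for
  \<open>\<kappa>\<close>. Minimality and the variational inequality both scale with
  \<open>D\<close> once the residual is written as \<open>y * \<delta>\<close>, and the negative
  term \<open>- y powr p\<close> from minimality absorbs \<open>K * y powr q\<close>.\<close>

lemma bregman_rate:
  fixes x \<sigma> \<delta> \<alpha> D W q b \<beta>1 \<beta>2 \<omega> \<omega>d \<xi>u :: real
  assumes pos: "0 < \<delta>" "0 < D" "0 \<le> x" "0 \<le> \<sigma>" "0 \<le> W" "0 \<le> \<beta>2" and q: "0 < q" "q < p"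
    and \<alpha>: "\<delta> powr p = \<alpha> * D" and W: "W * \<delta> powr q = D"
    and x: "x powr p + \<alpha> * \<omega> \<le> \<delta> powr p + \<alpha> * \<omega>d"
    and \<sigma>: "\<sigma> \<le> s * (x + \<delta>)"
    and b: "b = \<omega> - \<omega>d - \<xi>u"
    and vi: "- \<xi>u \<le> \<beta>1 * b + \<beta>2 * W * \<sigma> powr q + D"
  defines "K \<equiv> \<beta>2 * (c_const q * s powr q)"
  shows "(1 - \<beta>1) * b \<le> (2 + K + K * K powr (q / (p - q))) * D"
proof -
  define y where "y = x / \<delta>"
  have y: "0 \<le> y" "x = y * \<delta>" using pos by (auto simp: y_def)
  have "0 < \<alpha> * D" using \<alpha> pos by (metis powr_gt_zero less_numeral_extra(3))
  then have \<alpha>0: "0 < \<alpha>" using pos by (simp add: zero_less_mult_iff)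
  have "0 \<le> K"
    using one_le_c_const_mult[OF q(1)] pos by (simp add: K_def)
  have "\<alpha> * (\<omega> - \<omega>d) \<le> \<alpha> * (D * (1 - y powr p))"
    using x pos y by (simp add: powr_mult \<alpha> algebra_simps)
  then have 1: "\<omega> - \<omega>d \<le> D * (1 - y powr p)"
    using \<alpha>0 by simp
  have "\<beta>2 * W * \<sigma> powr q \<le> \<beta>2 * W * (c_const q * s powr q * (x powr q + \<delta> powr q))"
    using S_powr_le_of_quasi_triangle[OF \<sigma>] pos q by (intro mult_left_mono) auto
  also have "x powr q + \<delta> powr q = (y powr q + 1) * \<delta> powr q"
    using y pos by (simp add: powr_mult algebra_simps)
  also have "\<beta>2 * W * (c_const q * s powr q * ((y powr q + 1) * \<delta> powr q))
      = K * (y powr q + 1) * (W * \<delta> powr q)"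
    by (simp add: K_def mult_ac)
  finally have 2: "\<beta>2 * W * \<sigma> powr q \<le> D * (K * y powr q + K)"
    by (simp add: W algebra_simps)
  have 3: "b \<le> D * (1 - y powr p) + (\<beta>1 * b + D * (K * y powr q + K) + D)"
    using 1 2 vi b by linarith
  have "D * (K * y powr q) \<le> D * (y powr p + K * K powr (q / (p - q)))"
    using powr_le_powr_add_const[OF \<open>0 \<le> K\<close> y(1) q] pos by (intro mult_left_mono) auto
  then show ?thesis
    using 3 by (simp add: algebra_simps)
qed

end

section \<open>The convergence rate\<close>

theorem theorem4p6:
  fixes F :: "'u::{real_tvs,t2_space} \<Rightarrow> 'v::t2_space"
    and DF :: "'u set"
    and S :: "'v \<Rightarrow> 'v \<Rightarrow> ennreal"
    and \<Omega> :: "'u \<Rightarrow> ennreal"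
    and p s \<kappa> \<rho> \<alpha>b \<beta>1 \<beta>2 \<gamma> :: real
    and v0 :: 'v
    and vd :: "real \<Rightarrow> 'v"
    and ud :: 'u
    and \<xi> :: "'u \<Rightarrow> real"
    and d \<Psi> \<Phi> \<alpha> :: "real \<Rightarrow> real"
    and ua :: "real \<Rightarrow> 'u"
  assumes "tikhonov_setting F DF S \<Omega> p s v0 vd"
    and "Omega_minimizing_solution F DF \<Omega> v0 ud"
    and "0 < \<kappa>" and "\<kappa> < p"
    and "approx_variational_inequality F DF S \<Omega> p s v0 ud \<kappa> \<xi> \<rho> \<alpha>b \<beta>1 \<beta>2 \<gamma>"
    and "d = distance_function F DF S \<Omega> p v0 ud \<kappa> \<xi> \<rho> \<alpha>b \<beta>1 \<beta>2 \<gamma>"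
    and "\<And>r. r \<ge> 0 \<Longrightarrow> d r > 0"
    and "\<Psi> = (\<lambda>r. d r powr ((p - \<kappa>) / \<kappa>) * r powr (- (\<gamma> * p / \<kappa>)))"
    and "\<Phi> = (\<lambda>r. d r powr (1 / \<kappa>) * r powr (- (\<gamma> / \<kappa>)))"
    and "\<And>\<delta>. \<delta> > 0 \<Longrightarrow> \<alpha> \<delta> > 0"
    and "\<forall>\<^sub>F \<delta> in at_right 0. \<delta> powr p = \<alpha> \<delta> * d (the_inv_into {0<..} \<Psi> (\<alpha> \<delta>))"
    and "\<And>\<delta>. \<delta> > 0 \<Longrightarrow>
           is_arg_min (tikhonov F S \<Omega> p (vd \<delta>) (\<alpha> \<delta>)) (\<lambda>u. u \<in> tikh_domain DF \<Omega>) (ua \<delta>)"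
  shows "(\<lambda>\<delta>. real_of_ereal (bregman \<Omega> \<xi> (ua \<delta>) ud))
           \<in> O[at_right 0](\<lambda>\<delta>. d (the_inv_into {0<..} \<Phi> \<delta>))"
proof -
  interpret tikhonov_setting F DF S \<Omega> p s v0 vd by fact
  note \<kappa> = assms(3,4) and d_eq = assms(6) and d_pos = assms(7) and \<Psi> = assms(8) and \<Phi> = assms(9)
    and \<alpha>_pos = assms(10) and choice = assms(11) and min = assms(12)
  have ud: "ud \<in> tikh_domain DF \<Omega>" "F ud = v0"
    using assms(2) by (auto simp: Omega_minimizing_solution_def)
  then have ud': "ud \<in> DF" "\<Omega> ud < \<infinity>" by (auto simp: tikh_domain_def eff_domain_def)
  have \<xi>: "\<xi> \<in> subdifferential \<Omega> ud" and \<rho>_ennreal: "ennreal (c_const p * s powr p) * \<Omega> ud < ennreal \<rho>"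
    and \<alpha>b: "0 < \<alpha>b" and \<beta>: "0 \<le> \<beta>1" "\<beta>1 < 1" "0 \<le> \<beta>2" and "0 \<le> \<gamma>"
    and d_lim: "(d \<longlongrightarrow> 0) at_top"
    using assms(5) by (auto simp: approx_variational_inequality_def d_eq)
  define C where "C = c_const p * s powr p"
  have C: "1 \<le> C" using one_le_c_const_mult[OF p_pos] by (simp add: C_def)
  have "ennreal (C * enn2real (\<Omega> ud)) < ennreal \<rho>"
    using \<rho>_ennreal ud' C by (simp add: C_def ennreal_mult)
  \<comment> \<open>This strict gap later leaves room for the vanishing term
    \<open>2 * d (r \<delta>)\<close>.\<close>
  then have \<rho>: "C * enn2real (\<Omega> ud) < \<rho>"
    using C by (simp add: ennreal_less_iff)
  have "1 * enn2real (\<Omega> ud) \<le> C * enn2real (\<Omega> ud)"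
    using C by (intro mult_right_mono) auto
  then have \<rho>': "enn2real (\<Omega> ud) \<le> \<rho>" "0 < \<rho>"
    using \<rho> enn2real_nonneg[of "\<Omega> ud"] by linarith+

  \<comment> \<open>Otherwise \<open>d\<close> would be constant, contradicting \<open>0 < d r \<rightarrow> 0\<close>.\<close>
  have "\<gamma> \<noteq> 0"
  proof
    assume "\<gamma> = 0"
    then have "d = (\<lambda>r. d 0)"
      by (simp add: d_eq distance_function_def fun_eq_iff)
    then have "((\<lambda>r. d 0) \<longlongrightarrow> 0) (at_top :: real filter)" using d_lim by simp
    then show False using d_pos[of 0] by (simp add: tendsto_const_iff)
  qed
  with \<open>0 \<le> \<gamma>\<close> have \<gamma>: "0 < \<gamma>" by simp
  define M where "M = sublevel F DF S \<Omega> p v0 \<alpha>b (\<rho> * \<alpha>b)"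
  define A where "A u = - \<xi> (u - ud) - \<beta>1 * real_of_ereal (bregman \<Omega> \<xi> u ud)" for u
  define B where "B u = - \<beta>2 * enn2real (S (F u) v0) powr \<kappa>" for u
  have d_att: "\<exists>m\<in>M. d r = A m + r powr \<gamma> * B m"
    and d_ub: "u \<in> M \<Longrightarrow> A u + r powr \<gamma> * B u \<le> d r" for r u
    using distance_function_attained[OF ud'(1) ud(2) ud'(2) \<rho>'(1) \<xi> \<alpha>b \<rho>'(2) \<kappa>(1) \<beta>(1) less_imp_le[OF \<beta>(2)] \<beta>(3),
        where \<gamma> = \<gamma> and r = r] \<gamma>
    by (auto simp: M_def A_def B_def d_eq)
  \<comment> \<open>A maximizer at \<open>r'\<close> competes at \<open>r\<close>, and since
    \<open>B\<close> is nonpositive, the smaller weight gives it a larger value.\<close>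
  have d_antimono: "d r' \<le> d r" if "0 < r" "r \<le> r'" for r r'
  proof -
    obtain m where m: "m \<in> M" "d r' = A m + r' powr \<gamma> * B m" using d_att by blast
    have "r' powr \<gamma> * B m \<le> r powr \<gamma> * B m"
      using that \<gamma> \<beta> by (intro mult_right_mono_neg powr_mono2) (auto simp: B_def)
    then show ?thesis using m d_ub[OF m(1), of r] by simp
  qed
  \<comment> \<open>In the variable \<open>t = r powr \<gamma>\<close> the competitors are affine;
    substituting back gives continuity in \<open>r\<close>.\<close>
  have "continuous_on {0<..} (\<lambda>t. d (t powr (1 / \<gamma>)))"
  proof (rule continuous_on_attained_sup_affine)
    show "\<exists>m\<in>M. d (t powr (1 / \<gamma>)) = A m + t * B m" if "0 < t" for t
      using d_att[of "t powr (1 / \<gamma>)"] that \<gamma> by (simp add: powr_powr)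
    show "A u + t * B u \<le> d (t powr (1 / \<gamma>))" if "0 < t" "u \<in> M" for t u
      using d_ub[of u "t powr (1 / \<gamma>)"] that \<gamma> by (simp add: powr_powr)
  qed
  then have "continuous_on {0<..} (\<lambda>r. d ((r powr \<gamma>) powr (1 / \<gamma>)))"
    by (rule continuous_on_compose2) (auto intro!: continuous_on_powr' continuous_intros)
  then have d_cont: "continuous_on {0<..} d"
    using \<gamma> by (simp add: powr_powr cong: continuous_on_cong_simp)

  have d_pos': "0 < d r" if "0 < r" for r using d_pos that by simp
  have ex: "0 < (p - \<kappa>) / \<kappa>" "0 < \<gamma> * p / \<kappa>" "0 < 1 / \<kappa>" "0 < \<gamma> / \<kappa>"
    using \<kappa> \<gamma> by auto
  have \<Psi>_less: "\<Psi> r' < \<Psi> r" and \<Phi>_less: "\<Phi> r' < \<Phi> r" if "0 < r" "r < r'" for r r'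
    unfolding \<Psi> \<Phi> using that ex
    by (auto intro!: powr_decreasing_factor_less[of d] d_pos' d_antimono simp del: divide_minus_left)
  have \<Psi>_inj: "inj_on \<Psi> {0<..}" and \<Phi>_inj: "inj_on \<Phi> {0<..}"
    unfolding \<Psi> \<Phi> using ex
    by (auto intro!: powr_decreasing_factor_inj_on[of d] d_pos' d_antimono simp del: divide_minus_left)
  have \<Psi>_image: "\<Psi> ` {0<..} = {0<..}"
    unfolding \<Psi> using ex d_pos' d_antimono d_cont by (intro powr_decreasing_factor_image)
  define R where "R = the_inv_into {0<..} \<Psi>"
  have R: "0 < R a" "\<Psi> (R a) = a" if "0 < a" for a
  proof -
    have a: "a \<in> \<Psi> ` {0<..}" using that \<Psi>_image by simp
    show "0 < R a" using the_inv_into_into[OF \<Psi>_inj a order_refl] by (simp add: R_def)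
    show "\<Psi> (R a) = a" using f_the_inv_into_f[OF \<Psi>_inj a] by (simp add: R_def)
  qed
  define r where "r \<delta> = R (\<alpha> \<delta>)" for \<delta>
  have r: "0 < r \<delta>" "\<Psi> (r \<delta>) = \<alpha> \<delta>" if "0 < \<delta>" for \<delta>
    using R[OF \<alpha>_pos[OF that]] by (auto simp: r_def)

  have ev: "\<forall>\<^sub>F \<delta> in at_right 0. 0 < \<delta> \<and> \<delta> powr p = \<alpha> \<delta> * d (r \<delta>) \<and> \<Phi> (r \<delta>) = \<delta>"
    using choice eventually_at_right_less[of 0]
  proof eventually_elim
    case (elim \<delta>)
    then have eq: "\<delta> powr p = \<alpha> \<delta> * d (r \<delta>)" by (simp add: r_def R_def)
    note r\<delta> = r[OF elim(2)]
    \<comment> \<open>The extra factor \<open>d (r \<delta>)\<close> raises the exponent to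
      \<open>p / \<kappa>\<close>, so both exponents become \<open>p\<close> times those in
      \<open>\<Phi>\<close>.\<close>
    have "\<delta> powr p = d (r \<delta>) powr ((p - \<kappa>) / \<kappa> + 1) * r \<delta> powr (- (\<gamma> * p / \<kappa>))"
      using eq r\<delta>(2) d_pos'[OF r\<delta>(1)] by (simp add: \<Psi> powr_add)
    also have "(p - \<kappa>) / \<kappa> + 1 = 1 / \<kappa> * p" using \<kappa> by (simp add: field_simps)
    also have "- (\<gamma> * p / \<kappa>) = - (\<gamma> / \<kappa>) * p" by simp
    finally have "\<delta> powr p = \<Phi> (r \<delta>) powr p"
      using d_pos'[OF r\<delta>(1)] by (simp only: \<Phi> powr_powr[symmetric] powr_mult powr_ge_zero)
    then have "(\<delta> powr p) powr (1 / p) = (\<Phi> (r \<delta>) powr p) powr (1 / p)" by simp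
    moreover have "0 \<le> \<Phi> (r \<delta>)" by (simp add: \<Phi>)
    ultimately have "\<Phi> (r \<delta>) = \<delta>" using elim(2) p_pos by (simp add: powr_powr)
    then show ?case using eq elim(2) by simp
  qed

  \<comment> \<open>If \<open>r \<delta> \<le> Z\<close>, then
    \<open>\<delta> = \<Phi> (r \<delta>) \<ge> \<Phi> Z\<close>, which fails for small
    \<open>\<delta>\<close>.\<close>
  have r_gt: "\<forall>\<^sub>F \<delta> in at_right 0. Z < r \<delta>" if "0 < Z" for Z
  proof -
    have "0 < \<Phi> Z" using d_pos'[OF that] that by (simp add: \<Phi>)
    then have "\<forall>\<^sub>F \<delta> in at_right 0. \<delta> < \<Phi> Z"
      by (rule eventually_at_rightI[rotated]) auto
    with ev show ?thesis
    proof eventually_elim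
      case (elim \<delta>)
      then show ?case using \<Phi>_less[of "r \<delta>" Z] r(1)[of \<delta>] by (cases "r \<delta>" Z rule: linorder_cases) auto
    qed
  qed
  have r_lim: "filterlim r at_top (at_right 0)"
    unfolding filterlim_at_top
  proof
    fix Z
    show "\<forall>\<^sub>F \<delta> in at_right 0. Z \<le> r \<delta>"
      by (rule eventually_mono[OF r_gt[of "max Z 1"]]) auto
  qed
  have "((\<lambda>\<delta>. C * (2 * d (r \<delta>) + enn2real (\<Omega> ud))) \<longlongrightarrow> C * (2 * 0 + enn2real (\<Omega> ud))) (at_right 0)"
    by (intro tendsto_intros filterlim_compose[OF d_lim r_lim])
  then have ev\<rho>: "\<forall>\<^sub>F \<delta> in at_right 0. C * (2 * d (r \<delta>) + enn2real (\<Omega> ud)) < \<rho>"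
    using \<rho> by (intro order_tendstoD(2)) auto
  define K where "K = \<beta>2 * (c_const \<kappa> * s powr \<kappa>)"
  \<comment> \<open>The factor from \<open>bregman_rate\<close>, divided by
    \<open>1 - \<beta>1\<close> after moving \<open>\<beta>1 * b\<close> to the left.\<close>
  define c where "c = (2 + K + K * K powr (\<kappa> / (p - \<kappa>))) / (1 - \<beta>1)"
  show ?thesis
  proof (rule bigoI[of _ c])
    show "\<forall>\<^sub>F \<delta> in at_right 0. norm (real_of_ereal (bregman \<Omega> \<xi> (ua \<delta>) ud))
        \<le> c * norm (d (the_inv_into {0<..} \<Phi> \<delta>))"
      using ev ev\<rho> r_gt[OF R(1)[OF \<alpha>b]]
    proof eventually_elim
      case (elim \<delta>)
      then have \<delta>: "0 < \<delta>" and eq: "\<delta> powr p = \<alpha> \<delta> * d (r \<delta>)" and \<Phi>r: "\<Phi> (r \<delta>) = \<delta>" by auto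
      note r\<delta> = r[OF \<delta>] and a = \<alpha>_pos[OF \<delta>]
      have D: "0 < d (r \<delta>)" using d_pos'[OF r\<delta>(1)] .
      \<comment> \<open>The threshold \<open>R \<alpha>b\<close> was chosen for this:
        \<open>\<Psi>\<close> is decreasing and takes the values \<open>\<alpha> \<delta>\<close>
        and \<open>\<alpha>b\<close> at \<open>r \<delta>\<close> and
        \<open>R \<alpha>b\<close>.\<close>
      have "\<alpha> \<delta> \<le> \<alpha>b"
        using \<Psi>_less[OF R(1)[OF \<alpha>b] elim(3)] r\<delta>(2) R(2)[OF \<alpha>b] by simp
      moreover have "\<delta> powr p / \<alpha> \<delta> = d (r \<delta>)" using eq a by simp
      ultimately have uM: "ua \<delta> \<in> M"
        unfolding M_def using elim(2)
        by (intro minimizer_in_sublevel[OF \<delta> a _ ud min[OF \<delta>]]) (auto simp: C_def)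
      note est = minimizer_estimates[OF \<delta> a ud min[OF \<delta>]]
      have \<Omega>u: "\<Omega> (ua \<delta>) < \<infinity>" using est(1) by (simp add: tikh_domain_def eff_domain_def)
      define b where "b = real_of_ereal (bregman \<Omega> \<xi> (ua \<delta>) ud)"
      have b: "b = enn2real (\<Omega> (ua \<delta>)) - enn2real (\<Omega> ud) - \<xi> (ua \<delta> - ud)" "0 \<le> b"
        using \<Omega>u ud' real_of_ereal_bregman_nonneg[OF \<xi> \<Omega>u ud'(2)]
        by (auto simp: b_def real_of_ereal_bregman)
      have "\<delta> powr \<kappa> = d (r \<delta>) * r \<delta> powr (- \<gamma>)"
      proof -
        have "\<delta> powr \<kappa> = (d (r \<delta>) powr (1 / \<kappa>) * r \<delta> powr (- (\<gamma> / \<kappa>))) powr \<kappa>"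
          using \<Phi>r by (simp add: \<Phi>)
        also have "\<dots> = d (r \<delta>) * r \<delta> powr (- \<gamma>)"
          using \<kappa> D by (simp add: powr_mult powr_powr)
        finally show ?thesis .
      qed
      then have W: "r \<delta> powr \<gamma> * \<delta> powr \<kappa> = d (r \<delta>)"
        using r\<delta>(1) by (simp add: powr_minus field_simps)
      \<comment> \<open>The minimizer is a competitor in the maximum defining
        \<open>d (r \<delta>)\<close>.\<close>
      have vi: "- \<xi> (ua \<delta> - ud) \<le> \<beta>1 * b
          + \<beta>2 * (r \<delta> powr \<gamma>) * enn2real (S (F (ua \<delta>)) v0) powr \<kappa> + d (r \<delta>)"
        using d_ub[OF uM, of "r \<delta>"] by (simp add: A_def B_def b_def algebra_simps)
      have "(1 - \<beta>1) * b \<le> (2 + K + K * K powr (\<kappa> / (p - \<kappa>))) * d (r \<delta>)"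
        unfolding K_def
        by (rule bregman_rate[OF \<delta> D enn2real_nonneg enn2real_nonneg powr_ge_zero \<beta>(3) \<kappa> eq W est(3,4) b(1) vi])
      then have "b \<le> c * d (r \<delta>)"
        using \<beta>(2) by (simp add: c_def field_simps)
      \<comment> \<open>The parameter choice exhibits \<open>r \<delta>\<close> as a preimage of
        \<open>\<delta>\<close>, and injectivity makes it the only one.\<close>
      moreover have "the_inv_into {0<..} \<Phi> \<delta> = r \<delta>"
        using the_inv_into_f_f[OF \<Phi>_inj, of "r \<delta>"] r\<delta>(1) \<Phi>r by simp
      ultimately show ?case
        unfolding b_def[symmetric] using b(2) D by simp
    qed
  qed
qed

end
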